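(* Let $S$ be an arithmetic $k$-semiring. A proper ideal $I$ of $S$ is $k$-strongly irreducible if and only if it is $k$-irreducible.
   Context: A semiring is a commutative semiring $(S,+,0,\cdot,1)$ with multiplicative identity $1$ and additive identity $0$ that is absorbing. An ideal is a nonempty subset closed under addition and under multiplication by elements of $S$. A $k$-ideal is an ideal $I$ such that $x+y\in I$ and $y\in I$ imply $x\in I$. $S$ is a $k$-semiring if every ideal of $S$ is a $k$-ideal. $S$ is arithmetic if its lattice of ideals is distributive, i.e. $A+(B\cap C)=(A+B)\cap(A+C)$ (equivalently $A\cap(B+C)=(A\cap B)+(A\cap C)$) for all ideals $A,B,C$ of $S$. A $k$-ideal $I$ is $k$-strongly irreducible if for all $k$-ideals $A,B$ of $S$, $A\cap B\subseteq I$ implies $A\subseteq I$ or $B\subseteq I$; it is $k$-irreducible if for all $k$-ideals $A,B$ of $S$, $A\cap B=I$ implies $A=I$ or $B=I$. *)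

theory Defs
  imports Main "HOL-Library.Set_Algebras"
begin

text \<open>
  A semiring is a type of sort \<open>{comm_semiring_0, comm_monoid_mult}\<close>: commutative, with an absorbing
  zero and a multiplicative identity. The library class \<open>comm_semiring_1\<close> would in addition
  impose \<open>0 \<noteq> 1\<close>, which is not assumed here.
\<close>

definition semiring_ideal :: "'a::{comm_semiring_0, comm_monoid_mult} set \<Rightarrow> bool" where
  "semiring_ideal I \<longleftrightarrow>
     I \<noteq> {} \<and> (\<forall>x\<in>I. \<forall>y\<in>I. x + y \<in> I) \<and> (\<forall>s. \<forall>x\<in>I. s * x \<in> I)"

definition k_ideal :: "'a::{comm_semiring_0, comm_monoid_mult} set \<Rightarrow> bool" where
  "k_ideal I \<longleftrightarrow> semiring_ideal I \<and> (\<forall>x y. x + y \<in> I \<and> y \<in> I \<longrightarrow> x \<in> I)"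

definition k_semiring :: "'a::{comm_semiring_0, comm_monoid_mult} itself \<Rightarrow> bool" where
  "k_semiring _ \<longleftrightarrow> (\<forall>I :: 'a set. semiring_ideal I \<longrightarrow> k_ideal I)"

text \<open>
  The sum of sets is the elementwise sum of \<open>Set_Algebras\<close>, which for ideals is their join
  in the lattice of ideals.
\<close>

definition arithmetic_semiring :: "'a::{comm_semiring_0, comm_monoid_mult} itself \<Rightarrow> bool" where
  "arithmetic_semiring _ \<longleftrightarrow>
     (\<forall>A B C :: 'a set. semiring_ideal A \<and> semiring_ideal B \<and> semiring_ideal C \<longrightarrow>
        A + (B \<inter> C) = (A + B) \<inter> (A + C))"

definition k_strongly_irreducible :: "'a::{comm_semiring_0, comm_monoid_mult} set \<Rightarrow> bool" where
  "k_strongly_irreducible I \<longleftrightarrow>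
     k_ideal I \<and> (\<forall>A B. k_ideal A \<and> k_ideal B \<and> A \<inter> B \<subseteq> I \<longrightarrow> A \<subseteq> I \<or> B \<subseteq> I)"

definition k_irreducible :: "'a::{comm_semiring_0, comm_monoid_mult} set \<Rightarrow> bool" where
  "k_irreducible I \<longleftrightarrow>
     k_ideal I \<and> (\<forall>A B. k_ideal A \<and> k_ideal B \<and> A \<inter> B = I \<longrightarrow> A = I \<or> B = I)"

end

theory Submission
  imports Defs
begin

lemma semiring_ideal_zero:
  assumes "semiring_ideal I"
  shows "0 \<in> I"
proof -
  obtain x where "x \<in> I"
    using assms by (auto simp: semiring_ideal_def)
  \<comment> \<open>Ideals are only required to be nonempty, so 0 comes from absorption applied to
    an arbitrary element.\<close>
  then have "0 * x \<in> I"
    using assms by (simp only: semiring_ideal_def)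
  then show ?thesis by simp
qed

text \<open>This lets a \<open>k\<close>-semiring turn such sums into \<open>k\<close>-ideals. In
  general the sum of two \<open>k\<close>-ideals need not be one: in the natural numbers the
  multiples of 2 and of 3 add up to everything except 1.\<close>

lemma semiring_ideal_plus:
  assumes "semiring_ideal A" "semiring_ideal B"
  shows "semiring_ideal (A + B)"
  unfolding semiring_ideal_def
proof (intro conjI ballI allI)
  show "A + B \<noteq> {}"
    using set_plus_intro[OF assms[THEN semiring_ideal_zero]] by blast
next
  fix x y assume "x \<in> A + B" "y \<in> A + B"
  then obtain a b c d where "x = a + b" "y = c + d" "a \<in> A" "b \<in> B" "c \<in> A" "d \<in> B"
    by (auto elim!: set_plus_elim)
  moreover from this have "(a + c) + (b + d) \<in> A + B"
    using assms by (intro set_plus_intro) (auto simp: semiring_ideal_def)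
  ultimately show "x + y \<in> A + B"
    by (simp add: ac_simps)
next
  fix s x assume "x \<in> A + B"
  then obtain a b where "x = a + b" "a \<in> A" "b \<in> B"
    by (auto elim!: set_plus_elim)
  moreover from this have "s * a + s * b \<in> A + B"
    using assms by (intro set_plus_intro) (auto simp: semiring_ideal_def)
  ultimately show "s * x \<in> A + B"
    by (simp add: distrib_left)
qed

text \<open>Asking only \<open>0 \<in> C\<close> allows \<open>C\<close> to be
  \<open>A \<inter> B\<close> without first showing that an intersection of ideals is an
  ideal.\<close>

lemma semiring_ideal_plus_absorb:
  assumes "semiring_ideal I" "0 \<in> C" "C \<subseteq> I"
  shows "I + C = I"
proof
  show "I + C \<subseteq> I"
    using assms by (auto simp: semiring_ideal_def elim!: set_plus_elim)
  show "I \<subseteq> I + C"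
    using set_zero_plus2[OF assms(2), of I] by (simp add: add.commute)
qed

text \<open>If \<open>A \<inter> B = I\<close>, then \<open>I\<close> lies in both \<open>A\<close>
  and \<open>B\<close>, so either inclusion \<open>A \<subseteq> I\<close> or
  \<open>B \<subseteq> I\<close> is already an equality.\<close>

lemma k_strongly_irreducible_imp_k_irreducible:
  assumes "k_strongly_irreducible I"
  shows "k_irreducible I"
  using assms unfolding k_strongly_irreducible_def k_irreducible_def by blast

text \<open>
  If \<open>A \<inter> B \<subseteq> I\<close>, distributivity gives \<open>(I + A) \<inter> (I + B) = I + (A \<inter> B) = I\<close>,
  to which irreducibility applies, the sums being \<open>k\<close>-ideals in a \<open>k\<close>-semiring.
\<close>

lemma k_irreducible_imp_k_strongly_irreducible:
  fixes I :: "'a::{comm_semiring_0, comm_monoid_mult} set"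
  assumes "arithmetic_semiring TYPE('a)" "k_semiring TYPE('a)" "k_irreducible I"
  shows "k_strongly_irreducible I"
  unfolding k_strongly_irreducible_def
proof (intro conjI allI impI)
  show "k_ideal I"
    using assms(3) by (simp add: k_irreducible_def)
  then have I: "semiring_ideal I"
    by (simp add: k_ideal_def)
  fix A B :: "'a set"
  assume AB: "k_ideal A \<and> k_ideal B \<and> A \<inter> B \<subseteq> I"
  then have A: "semiring_ideal A" and B: "semiring_ideal B"
    by (simp_all add: k_ideal_def)
  have "(I + A) \<inter> (I + B) = I + (A \<inter> B)"
    using assms(1) I A B by (simp add: arithmetic_semiring_def)
  also have "\<dots> = I"
    using I A B AB by (intro semiring_ideal_plus_absorb) (auto intro: semiring_ideal_zero)
  finally have "(I + A) \<inter> (I + B) = I" .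
  moreover have "k_ideal (I + A)" "k_ideal (I + B)"
    using assms(2) I A B by (auto simp: k_semiring_def intro: semiring_ideal_plus)
  ultimately have "I + A = I \<or> I + B = I"
    using assms(3) by (simp add: k_irreducible_def)
  \<comment> \<open>Since \<open>0 \<in> I\<close>, each summand embeds in its sum with
    \<open>I\<close>; hence a sum that collapses to \<open>I\<close> forces its summand into
    \<open>I\<close>.\<close>
  moreover have "A \<subseteq> I + A" "B \<subseteq> I + B"
    using semiring_ideal_zero[OF I] by (auto intro: set_zero_plus2[THEN subsetD])
  ultimately show "A \<subseteq> I \<or> B \<subseteq> I"
    by auto
qed

theorem theorem3p14:
  fixes I :: "'a::{comm_semiring_0, comm_monoid_mult} set"
  assumes "arithmetic_semiring TYPE('a)"
    and "k_semiring TYPE('a)"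
    and "semiring_ideal I"
    and "I \<noteq> UNIV"
  shows "k_strongly_irreducible I \<longleftrightarrow> k_irreducible I"
  using k_strongly_irreducible_imp_k_irreducible
    k_irreducible_imp_k_strongly_irreducible[OF assms(1,2)] by blast

end
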